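(* Let $\{P_\theta\}_{\theta\in\Theta}$ be a family of probability distributions for real-valued data $(X_1,\dots,X_n)$, with $\Theta$ partitioned into $\Theta_0$ (null) and $\Theta_1$ (alternative), such that $X_1,\dots,X_n$ are exchangeable (for instance i.i.d.) under $P_\theta$ for every $\theta\in\Theta$. Let $E=E(X_1,\dots,X_n)$ be an e-variable for $\Theta_0$ and define $$G=\frac1{n!}\sum_{\pi}E(X_{\pi(1)},\dots,X_{\pi(n)}),$$ where $\pi$ runs over the set of permutations of $\{1,\dots,n\}$. Then $G$ is an e-variable for $\Theta_0$; for every $\theta\in\Theta$ and every concave utility function $f$, $\mathbb{E}_\theta[f(G)]\ge\mathbb{E}_\theta[f(E)]$, assuming both expectations are well-defined; and $\mathbb{E}_\theta[\log(E/G)]\le0$ for every $\theta\in\Theta$.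
   Context: $\mathbb{E}_\theta$ denotes expectation under $P_\theta$; $\mathbb{E}[Y]$ is well-defined as an element of $[-\infty,\infty]$ if $\mathbb{E}[Y^+]$ or $\mathbb{E}[Y^-]$ is finite. An e-variable for $\Theta_0$ is a $[0,\infty]$-valued measurable function $E$ of the data with $\mathbb{E}_\theta[E]\le1$ for all $\theta\in\Theta_0$. A concave utility function is a concave function $f:(0,\infty)\to\mathbb{R}$, extended to $f:[0,\infty]\to[-\infty,\infty]$ by $f(0):=\lim_{x\downarrow0}f(x)$ and $f(\infty):=\lim_{x\to\infty}f(x)$. Ratios use the conventions $0/0=0$ and $\infty/\infty=1$; also $\log0=-\infty$, $\log\infty=\infty$. *)

theory Defs
  imports "HOL-Probability.Probability"
begin

(* The data X_1, ..., X_n are the coordinates of a point x of this product space, so that a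
   distribution of the data is a probability measure on it. Its points are functions that take
   the value undefined outside {1..n}; as a permutation p of {1..n} fixes everything outside
   {1..n}, the point (x_{p(1)}, ..., x_{p(n)}) is simply x o p. *)
definition data_space :: "nat \<Rightarrow> (nat \<Rightarrow> real) measure" where
  "data_space n = PiM {1..n} (\<lambda>_. borel)"

definition data_distribution :: "nat \<Rightarrow> (nat \<Rightarrow> real) measure \<Rightarrow> bool" where
  "data_distribution n P \<longleftrightarrow> prob_space P \<and> sets P = sets (data_space n)"

definition exchangeable :: "nat \<Rightarrow> (nat \<Rightarrow> real) measure \<Rightarrow> bool" where
  "exchangeable n P \<longleftrightarrow> (\<forall>p. p permutes {1..n} \<longrightarrow> distr P (data_space n) (\<lambda>x. x \<circ> p) = P)"

definition is_evariable ::
    "nat \<Rightarrow> ('t \<Rightarrow> (nat \<Rightarrow> real) measure) \<Rightarrow> 't set \<Rightarrow> ((nat \<Rightarrow> real) \<Rightarrow> ennreal) \<Rightarrow> bool" where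
  "is_evariable n P \<Theta>0 E \<longleftrightarrow>
     E \<in> borel_measurable (data_space n) \<and> (\<forall>\<theta>\<in>\<Theta>0. (\<integral>\<^sup>+ x. E x \<partial>P \<theta>) \<le> 1)"

definition symmetrization :: "nat \<Rightarrow> ((nat \<Rightarrow> real) \<Rightarrow> ennreal) \<Rightarrow> (nat \<Rightarrow> real) \<Rightarrow> ennreal" where
  "symmetrization n E x = (\<Sum>p\<in>{p. p permutes {1..n}}. E (x \<circ> p)) / of_nat (fact n)"

definition expect_pos :: "'a measure \<Rightarrow> ('a \<Rightarrow> ereal) \<Rightarrow> ennreal" where
  "expect_pos M Y = (\<integral>\<^sup>+ x. e2ennreal (max 0 (Y x)) \<partial>M)"

definition expect_neg :: "'a measure \<Rightarrow> ('a \<Rightarrow> ereal) \<Rightarrow> ennreal" where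
  "expect_neg M Y = (\<integral>\<^sup>+ x. e2ennreal (max 0 (- Y x)) \<partial>M)"

definition expect_well_defined :: "'a measure \<Rightarrow> ('a \<Rightarrow> ereal) \<Rightarrow> bool" where
  "expect_well_defined M Y \<longleftrightarrow> expect_pos M Y < \<infinity> \<or> expect_neg M Y < \<infinity>"

(* Meaningful only under expect_well_defined: in ereal, \<infinity> - \<infinity> = \<infinity>. *)
definition expect :: "'a measure \<Rightarrow> ('a \<Rightarrow> ereal) \<Rightarrow> ereal" where
  "expect M Y = enn2ereal (expect_pos M Y) - enn2ereal (expect_neg M Y)"

(* Only the values of f on {0<..} matter. For f concave on {0<..} both limits exist in
   [-\<infinity>,\<infinity>]; monotonicity of f is not required. *)
definition extend_utility :: "(real \<Rightarrow> real) \<Rightarrow> ennreal \<Rightarrow> ereal" where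
  "extend_utility f y =
     (if y = 0 then Lim (at_right 0) (\<lambda>x. ereal (f x))
      else if y = \<infinity> then Lim at_top (\<lambda>x. ereal (f x))
      else ereal (f (enn2real y)))"

definition ext_log :: "ennreal \<Rightarrow> ereal" where
  "ext_log y = (if y = 0 then -\<infinity> else if y = \<infinity> then \<infinity> else ereal (ln (enn2real y)))"

(* Division on ennreal gives 0 / 0 = 0, as wanted, but \<infinity> / \<infinity> = 0. *)
definition ext_ratio :: "ennreal \<Rightarrow> ennreal \<Rightarrow> ennreal" where
  "ext_ratio a b = (if a = \<infinity> \<and> b = \<infinity> then 1 else a / b)"

end

(* By exchangeability, E and each of its permuted copies have the same distribution, and G is the
   average of the copies. Hence G has the expectation of E, and Jensen's inequality applied pointwise
   to this average gives the claim on utilities; at G = \<infinity> it needs that a concave f either is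
   increasing or tends to -\<infinity>. As G is symmetric, the ratio E/G has the same expectation as the
   average of the ratios of the copies to G, which is at most 1; then use log r \<le> r - 1. *)
theory Submission
  imports Defs "HOL-Real_Asymp.Real_Asymp"
begin

section \<open>Tangents and monotonicity of concave functions\<close>

text \<open>The slope is the right derivative of \<open>f\<close> at \<open>x\<close>: for the
  convex function \<open>- f\<close> the right derivative is the infimum of the secant slopes to the
  right of \<open>x\<close>, which is \<open>?d\<close>.\<close>

lemma concave_on_tangent:
  fixes f :: "real \<Rightarrow> real"
  assumes "concave_on S f" "open S" "x \<in> S"
  obtains c where "\<And>y. y \<in> S \<Longrightarrow> f y \<le> f x + c * (y - x)"
proof -
  let ?d = "Inf ((\<lambda>t. (- f x - - f t) / (x - t)) ` ({x<..} \<inter> S))"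
  have "f y \<le> f x + (- ?d) * (y - x)" if "y \<in> S" for y
    using convex_le_Inf_differential[of S "\<lambda>x. - f x" x y] assms that
    by (simp add: concave_on_def interior_open)
  then show thesis by (rule that)
qed

text \<open>If \<open>f\<close> falls anywhere from \<open>x\<close> to \<open>y\<close>, the
  tangent at \<open>y\<close> has negative slope. Lying above \<open>f\<close>, it drags
  \<open>f\<close> down to minus infinity.\<close>

lemma concave_increasing_or_unbounded_below:
  fixes f :: "real \<Rightarrow> real"
  assumes "concave_on {0<..} f"
  shows "mono_on {0<..} f \<or> ((\<lambda>x. ereal (f x)) \<longlongrightarrow> -\<infinity>) at_top"
proof (rule disjCI)
  assume "\<not> ((\<lambda>x. ereal (f x)) \<longlongrightarrow> -\<infinity>) at_top"
  show "mono_on {0<..} f"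
  proof (rule ccontr)
    assume "\<not> mono_on {0<..} f"
    then obtain x y where xy: "0 < x" "x < y" "f y < f x"
      by (auto simp: mono_on_def not_le) (metis less_irrefl order_le_less)
    obtain c where c: "\<And>z. z \<in> {0<..} \<Longrightarrow> f z \<le> f y + c * (z - y)"
      using concave_on_tangent[OF assms, of y] xy by auto
    have "0 < c * (x - y)" using c[of x] xy by auto
    then have "c < 0" using xy by (simp add: zero_less_mult_iff)
    then have "filterlim (\<lambda>z. f y + c * (z - y)) at_bot at_top"
      by real_asymp
    then have "filterlim f at_bot at_top"
      by (rule filterlim_at_bot_mono)
         (use c in \<open>auto intro!: eventually_mono[OF eventually_gt_at_top[of 0]]\<close>)
    then have "((\<lambda>x. ereal (f x)) \<longlongrightarrow> -\<infinity>) at_top"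
      by (simp add: tendsto_MInfty filterlim_at_bot_dense)
    with \<open>\<not> ((\<lambda>x. ereal (f x)) \<longlongrightarrow> -\<infinity>) at_top\<close> show False by blast
  qed
qed

text \<open>In both cases \<open>f\<close> is monotone near 0, which is what makes its limit there
  exist. If \<open>f\<close> rises from \<open>x\<close> to some larger \<open>y\<close>, then all
  tangents at points up to \<open>x\<close> have nonnegative slope.\<close>

lemma concave_decreasing_or_increasing_near_0:
  fixes f :: "real \<Rightarrow> real"
  assumes "concave_on {0<..} f"
  obtains "antimono_on {0<..} f" | a where "0 < a" "mono_on {0<..a} f"
proof (cases "antimono_on {0<..} f")
  case False
  then obtain x y where xy: "0 < x" "x < y" "f x < f y"
    by (auto simp: monotone_on_def not_le) (metis less_irrefl order_le_less)
  obtain c where c: "\<And>z. z \<in> {0<..} \<Longrightarrow> f z \<le> f x + c * (z - x)"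
    using concave_on_tangent[OF assms, of x] xy by auto
  have "0 < c * (y - x)" using c[of y] xy by auto
  then have "0 < c" using xy by (simp add: zero_less_mult_iff)
  have "f u \<le> f v" if uv: "0 < u" "u \<le> v" "v \<le> x" for u v
  proof -
    obtain d where d: "\<And>z. z \<in> {0<..} \<Longrightarrow> f z \<le> f v + d * (z - v)"
      using concave_on_tangent[OF assms, of v] uv by auto
    have "0 \<le> d"
    proof (cases "v = x")
      case True
      then have "0 < d * (y - x)" using d[of y] xy by auto
      then show ?thesis using xy by (simp add: zero_less_mult_iff)
    next
      case False
      \<comment> \<open>This is the sum of two tangent inequalities, the one at \<open>x\<close>
        evaluated at \<open>v\<close> and the one at \<open>v\<close> evaluated at \<open>x\<close>:
        tangent slopes decrease from left to right.\<close>
      have "0 \<le> (d - c) * (x - v)"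
        using c[of v] d[of x] uv xy by (simp add: algebra_simps)
      then show ?thesis using False uv \<open>0 < c\<close> by (auto simp: zero_le_mult_iff)
    qed
    moreover have "f u \<le> f v + d * (u - v)" using d uv by auto
    ultimately show ?thesis
      using uv mult_nonneg_nonpos[of d "u - v"] by auto
  qed
  then have "mono_on {0<..x} f" by (auto simp: mono_on_def)
  with \<open>0 < x\<close> show thesis by (rule that(2))
qed (rule that(1))

section \<open>Extension of a concave utility to 0 and infinity\<close>

text \<open>\<open>Lim\<close> is unspecified unless a limit exists. Monotonicity near 0 supplies
  one: a supremum if \<open>f\<close> is decreasing, an infimum over an initial interval
  otherwise.\<close>

lemma concave_tendsto_at_right_0:
  fixes f :: "real \<Rightarrow> real"
  assumes "concave_on {0<..} f"
  shows "((\<lambda>x. ereal (f x)) \<longlongrightarrow> extend_utility f 0) (at_right 0)"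
proof -
  have "\<exists>l. ((\<lambda>x. ereal (f x)) \<longlongrightarrow> l) (at_right 0)"
  proof (rule concave_decreasing_or_increasing_near_0[OF assms])
    assume anti: "antimono_on {0<..} f"
    have "((\<lambda>x. ereal (f x)) \<longlongrightarrow> (SUP x\<in>{0<..}. ereal (f x))) (at_right 0)"
    proof (rule increasing_tendsto)
      show "\<forall>\<^sub>F x in at_right 0. ereal (f x) \<le> (SUP x\<in>{0<..}. ereal (f x))"
        by (auto intro!: SUP_upper eventually_at_rightI[of 0 1])
    next
      fix l assume "l < (SUP x\<in>{0<..}. ereal (f x))"
      then obtain b where b: "0 < b" "l < ereal (f b)" by (auto simp: less_SUP_iff)
      have "l < ereal (f x)" if "0 < x" "x < b" for x
        using b(2) monotone_onD[OF anti, of x b] that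
        by (auto elim!: order.strict_trans2)
      then show "\<forall>\<^sub>F x in at_right 0. l < ereal (f x)"
        using b by (auto intro!: eventually_at_rightI[of 0 b])
    qed
    then show ?thesis by blast
  next
    fix a assume a: "0 < a" and mono: "mono_on {0<..a} f"
    have "((\<lambda>x. ereal (f x)) \<longlongrightarrow> (INF x\<in>{0<..a}. ereal (f x))) (at_right 0)"
    proof (rule decreasing_tendsto)
      show "\<forall>\<^sub>F x in at_right 0. (INF x\<in>{0<..a}. ereal (f x)) \<le> ereal (f x)"
        using a by (auto intro!: INF_lower eventually_at_rightI[of 0 a])
    next
      fix l assume "(INF x\<in>{0<..a}. ereal (f x)) < l"
      then obtain b where b: "0 < b" "b \<le> a" "ereal (f b) < l" by (auto simp: INF_less_iff)
      have "ereal (f x) < l" if "0 < x" "x < b" for x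
        using b monotone_onD[OF mono, of x b] that
        by (auto elim!: order.strict_trans1[rotated])
      then show "\<forall>\<^sub>F x in at_right 0. ereal (f x) < l"
        using b by (auto intro!: eventually_at_rightI[of 0 b])
    qed
    then show ?thesis by blast
  qed
  then show ?thesis
    using tendsto_Lim[OF trivial_limit_at_right_real] by (auto simp: extend_utility_def)
qed

lemma extend_utility_0_le:
  fixes f :: "real \<Rightarrow> real"
  assumes "concave_on {0<..} f" and bound: "\<And>z. z > 0 \<Longrightarrow> f z \<le> b + c * z"
  shows "extend_utility f 0 \<le> ereal b"
proof (rule tendsto_le[OF trivial_limit_at_right_real _ concave_tendsto_at_right_0[OF assms(1)]])
  show "((\<lambda>z. ereal (b + c * z)) \<longlongrightarrow> ereal b) (at_right 0)"
    by (intro tendsto_eq_intros) auto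
  show "\<forall>\<^sub>F z in at_right 0. ereal (f z) \<le> ereal (b + c * z)"
    using bound by (auto intro!: eventually_at_rightI[of 0 1])
qed

text \<open>The tangent bound passes to the limit at 0, so Jensen's inequality can treat copies that
  vanish like positive finite ones.\<close>

lemma extend_utility_tangent:
  fixes f :: "real \<Rightarrow> real"
  assumes "concave_on {0<..} f" "0 < g"
  obtains c where "\<And>y. 0 \<le> y \<Longrightarrow> extend_utility f (ennreal y) \<le> ereal (f g + c * (y - g))"
proof -
  obtain c where c: "\<And>z. z \<in> {0<..} \<Longrightarrow> f z \<le> f g + c * (z - g)"
    using concave_on_tangent[OF assms(1), of g] assms(2) by auto
  have "extend_utility f (ennreal y) \<le> ereal (f g + c * (y - g))" if "0 \<le> y" for y
  proof (cases "y = 0")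
    case True
    have "extend_utility f 0 \<le> ereal (f g - c * g)"
      by (rule extend_utility_0_le[OF assms(1), of _ c]) (use c in \<open>auto simp: algebra_simps\<close>)
    then show ?thesis using True by simp
  next
    case False
    then show ?thesis using c[of y] that by (auto simp: extend_utility_def)
  qed
  then show thesis by (rule that)
qed

text \<open>A limit other than minus infinity forces \<open>f\<close> to be increasing, and then the
  limit is the supremum of \<open>f\<close>. If the value at infinity is minus infinity, Jensen's
  inequality holds at an infinite average for another reason: an infinite negative part.\<close>

lemma extend_utility_le_top:
  fixes f :: "real \<Rightarrow> real"
  assumes f: "concave_on {0<..} f" and "extend_utility f \<infinity> \<noteq> -\<infinity>"
  shows "extend_utility f y \<le> extend_utility f \<infinity>"
proof -
  have top: "extend_utility f \<infinity> = Lim at_top (\<lambda>x. ereal (f x))"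
    by (simp add: extend_utility_def)
  have "\<not> ((\<lambda>x. ereal (f x)) \<longlongrightarrow> -\<infinity>) at_top"
    using assms(2) tendsto_Lim[of at_top "\<lambda>x. ereal (f x)" "-\<infinity>"] top by auto
  then have mono: "mono_on {0<..} f"
    using concave_increasing_or_unbounded_below[OF f] by blast
  have "((\<lambda>x. ereal (f x)) \<longlongrightarrow> (SUP x\<in>{0<..}. ereal (f x))) at_top"
  proof (rule increasing_tendsto)
    show "\<forall>\<^sub>F x in at_top. ereal (f x) \<le> (SUP x\<in>{0<..}. ereal (f x))"
      by (auto intro!: SUP_upper eventually_mono[OF eventually_gt_at_top[of 0]])
  next
    fix l assume "l < (SUP x\<in>{0<..}. ereal (f x))"
    then obtain b where b: "0 < b" "l < ereal (f b)" by (auto simp: less_SUP_iff)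
    have "l < ereal (f x)" if "b < x" for x
      using b monotone_onD[OF mono, of b x] that by (auto elim!: order.strict_trans2)
    then show "\<forall>\<^sub>F x in at_top. l < ereal (f x)"
      by (auto intro!: eventually_mono[OF eventually_gt_at_top[of b]])
  qed
  then have sup: "extend_utility f \<infinity> = (SUP x\<in>{0<..}. ereal (f x))"
    unfolding top by (intro tendsto_Lim) auto
  consider "y = 0" | "y = \<infinity>" | r where "0 < r" "y = ennreal r"
    by (cases y) (auto simp: order_le_less)
  then show ?thesis
  proof cases
    case 1
    have "((\<lambda>x. ereal (f x)) \<longlongrightarrow> extend_utility f 0) (at_right 0)"
      by (rule concave_tendsto_at_right_0[OF f])
    then have "extend_utility f 0 \<le> (SUP x\<in>{0<..}. ereal (f x))"
      by (rule tendsto_upperbound) (auto intro!: SUP_upper eventually_at_rightI[of 0 1])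
    then show ?thesis using 1 sup by simp
  next
    case 3
    then have "extend_utility f y = ereal (f r)" by (simp add: extend_utility_def)
    also have "\<dots> \<le> extend_utility f \<infinity>" unfolding sup using 3 by (auto intro!: SUP_upper)
    finally show ?thesis .
  qed auto
qed

lemma borel_measurable_extend_utility:
  fixes f :: "real \<Rightarrow> real"
  assumes "concave_on {0<..} f"
  shows "extend_utility f \<in> borel_measurable borel"
proof -
  have "continuous_on {0<..} f"
    using convex_on_continuous[of "{0<..}" "\<lambda>x. - f x"] assms
    by (auto simp: concave_on_def dest: continuous_on_minus)
  \<comment> \<open>Concavity gives continuity only on the open half-line. The indicator suppresses
    the arbitrary values of \<open>f\<close> elsewhere.\<close>
  then have [measurable]: "(\<lambda>x. indicator {0<..} x * f x) \<in> borel_measurable borel"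
    using borel_measurable_continuous_on_indicator[of "{0<..}" f] by simp
  have "extend_utility f = (\<lambda>y. if y = 0 then extend_utility f 0
      else if y = \<infinity> then extend_utility f \<infinity>
      else ereal (indicator {0<..} (enn2real y) * f (enn2real y)))"
    by (auto simp: fun_eq_iff extend_utility_def indicator_def enn2real_positive_iff less_top
        zero_less_iff_neq_zero)
  also have "\<dots> \<in> borel_measurable borel" by measurable
  finally show ?thesis .
qed

lemma borel_measurable_ext_log: "ext_log \<in> borel_measurable borel"
  unfolding ext_log_def by measurable

lemma borel_measurable_ext_ratio:
  assumes [measurable]: "f \<in> borel_measurable M" "g \<in> borel_measurable M"
  shows "(\<lambda>x. ext_ratio (f x) (g x)) \<in> borel_measurable M"
  unfolding ext_ratio_def by measurable

section \<open>Pointwise inequalities for finite averages\<close>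

text \<open>This is the integrand of \<open>expect_pos\<close>; applied to \<open>- Y x\<close> it
  is that of \<open>expect_neg\<close>.\<close>

abbreviation pos_part :: "ereal \<Rightarrow> ennreal" where
  "pos_part y \<equiv> e2ennreal (max 0 y)"

lemma pos_part_ereal: "pos_part (ereal r) = ennreal (max 0 r)"
  by (metis e2ennreal_ereal ereal_max_0)

lemma pos_part_mono: "y \<le> z \<Longrightarrow> pos_part y \<le> pos_part z"
  by (intro e2ennreal_mono max.mono) auto

text \<open>Jensen's inequality with the negative parts moved to the other side: no subtraction occurs, so
  the statement survives infinite values.\<close>
lemma extend_utility_average:
  fixes f :: "real \<Rightarrow> real" and e :: "'i \<Rightarrow> ennreal"
  assumes f: "concave_on {0<..} f" and I: "finite I" "I \<noteq> {}"
    and g: "g = (\<Sum>i\<in>I. e i) / of_nat (card I)"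
  shows "(\<Sum>i\<in>I. pos_part (extend_utility f (e i))) + of_nat (card I) * pos_part (- extend_utility f g)
    \<le> of_nat (card I) * pos_part (extend_utility f g) + (\<Sum>i\<in>I. pos_part (- extend_utility f (e i)))"
    (is "?A + ?D \<le> ?C + ?B")
proof -
  let ?F = "extend_utility f" and ?N = "card I"
  have N: "?N > 0" using I by (simp add: card_gt_0_iff)
  \<comment> \<open>A single copy of utility minus infinity makes the right side infinite.\<close>
  have unbounded: ?thesis if "\<exists>i\<in>I. ?F (e i) = -\<infinity>"
  proof -
    from that obtain i where i: "i \<in> I" "?F (e i) = -\<infinity>" by blast
    then have "pos_part (- ?F (e i)) = \<top>" by (simp add: max_def)
    then have "?B = \<top>" using i I by (metis ennreal_sum_eq_top)
    then show ?thesis by simp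
  qed
  \<comment> \<open>If no copy has larger utility than the average, the claim holds term by
    term.\<close>
  have dominated: ?thesis if "\<forall>i\<in>I. ?F (e i) \<le> ?F g"
  proof (rule add_mono)
    show "(\<Sum>i\<in>I. pos_part (?F (e i))) \<le> of_nat ?N * pos_part (?F g)"
      using that by (intro sum_bounded_above pos_part_mono) auto
    show "of_nat ?N * pos_part (- ?F g) \<le> ?B"
      using that by (intro sum_bounded_below pos_part_mono) auto
  qed
  consider "g = \<infinity>" | "g = 0" | r where "0 < r" "g = ennreal r"
    by (cases g) (auto simp: order_le_less)
  then show ?thesis
  proof cases
    case 1
    then have "(\<Sum>i\<in>I. e i) = \<top>"
      using g N by (auto simp: ennreal_divide_eq_top_iff)
    then obtain i where "i \<in> I" "e i = \<top>" using I by (auto simp: ennreal_sum_eq_top)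
    \<comment> \<open>Some copy is infinite like \<open>g\<close>. Either its utility is minus
      infinity, or the utility at infinity is maximal.\<close>
    then show ?thesis
      using unbounded dominated extend_utility_le_top[OF f] 1 by (metis infinity_ennreal_def)
  next
    case 2
    then have "\<forall>i\<in>I. e i = 0"
      using g I by (auto simp: ennreal_divide_eq_0_iff)
    then show ?thesis using dominated 2 by simp
  next
    case 3
    have "(\<Sum>i\<in>I. e i) \<noteq> \<top>"
      using 3 g by (auto simp: ennreal_top_divide)
    then have fin: "e i \<noteq> \<top>" if "i \<in> I" for i
      using I that by (auto simp: ennreal_sum_eq_top)
    define y where "y i = enn2real (e i)" for i
    have y: "e i = ennreal (y i)" if "i \<in> I" for i using fin[OF that] by (simp add: y_def less_top)
    have y0: "0 \<le> y i" for i by (simp add: y_def)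
    have "ennreal r = ennreal ((\<Sum>i\<in>I. y i) / ?N)"
      using g 3 y y0 N
      by (simp add: divide_ennreal[symmetric] sum_nonneg ennreal_of_nat_eq_real_of_nat cong: sum.cong)
    then have "r = (\<Sum>i\<in>I. y i) / ?N"
      using 3 y0 by (subst (asm) ennreal_inj) (auto intro!: sum_nonneg divide_nonneg_nonneg)
    then have ysum: "(\<Sum>i\<in>I. y i) = ?N * r" using N by simp
    obtain c where c: "\<And>y. 0 \<le> y \<Longrightarrow> ?F (ennreal y) \<le> ereal (f r + c * (y - r))"
      using extend_utility_tangent[OF f 3(1)] by blast
    show ?thesis
    proof (cases "\<exists>i\<in>I. ?F (e i) = -\<infinity>")
      case False
      define h where "h i = real_of_ereal (?F (e i))" for i
      \<comment> \<open>The tangent bound excludes the value plus infinity and the case assumption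
        excludes minus infinity, so all utilities are real numbers.\<close>
      have h: "?F (e i) = ereal (h i)" and hc: "h i \<le> f r + c * (y i - r)" if "i \<in> I" for i
        using c[OF y0, of i] False that y[OF that] unfolding h_def
        by (cases "?F (e i)"; force)+
      have Fg: "?F g = ereal (f r)" using 3 by (simp add: extend_utility_def)
      \<comment> \<open>The tangent is taken at the mean \<open>r\<close> of the \<open>y i\<close>,
        so its linear terms cancel in the sum.\<close>
      have "(\<Sum>i\<in>I. h i) \<le> (\<Sum>i\<in>I. f r + c * (y i - r))" by (intro sum_mono hc)
      also have "\<dots> = ?N * f r"
        by (simp add: sum.distrib sum_subtractf ysum flip: sum_distrib_left)
      finally have "(\<Sum>i\<in>I. max 0 (h i) - max 0 (- h i)) \<le> ?N * (max 0 (f r) - max 0 (- f r))"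
        by (simp add: max_def if_distrib[of "\<lambda>x. _ - x"] cong: if_cong)
      then have le: "(\<Sum>i\<in>I. max 0 (h i)) + ?N * max 0 (- f r) \<le> ?N * max 0 (f r) + (\<Sum>i\<in>I. max 0 (- h i))"
        by (simp add: sum_subtractf algebra_simps)
      have "?A + ?D = ennreal ((\<Sum>i\<in>I. max 0 (h i)) + ?N * max 0 (- f r))"
        by (simp add: Fg h pos_part_ereal sum_nonneg ennreal_mult ennreal_of_nat_eq_real_of_nat
            del: ennreal_max_0 ennreal_max_0' cong: sum.cong)
      also have "\<dots> \<le> ennreal (?N * max 0 (f r) + (\<Sum>i\<in>I. max 0 (- h i)))"
        using le by (rule ennreal_leI)
      also have "\<dots> = ?C + ?B"
        by (simp add: Fg h pos_part_ereal sum_nonneg ennreal_mult ennreal_of_nat_eq_real_of_nat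
            del: ennreal_max_0 ennreal_max_0' cong: sum.cong)
      finally show ?thesis .
    qed (rule unbounded)
  qed
qed

text \<open>For \<open>g\<close> positive and finite the sum equals \<open>card I\<close>. It can be
  smaller in the other cases: all ratios are 0 / 0 = 0 if \<open>g\<close> is 0, and each is 0 or 1
  if \<open>g\<close> is infinite.\<close>

lemma sum_ext_ratio_average_le:
  fixes e :: "'i \<Rightarrow> ennreal"
  assumes "finite I" and g: "g = (\<Sum>i\<in>I. e i) / of_nat (card I)"
  shows "(\<Sum>i\<in>I. ext_ratio (e i) g) \<le> of_nat (card I)"
proof (cases "g = \<infinity>")
  case True
  then have "(\<Sum>i\<in>I. ext_ratio (e i) g) \<le> of_nat (card I) * 1"
    by (intro sum_bounded_above) (auto simp: ext_ratio_def)
  then show ?thesis by simp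
next
  case False
  have "(\<Sum>i\<in>I. ext_ratio (e i) g) = (\<Sum>i\<in>I. e i) / g"
    using False by (simp add: ext_ratio_def divide_ennreal_def sum_distrib_right)
  also have "\<dots> \<le> of_nat (card I)"
  proof (cases "card I = 0")
    case True
    with \<open>finite I\<close> show ?thesis by simp
  next
    case card: False
    then have s: "(\<Sum>i\<in>I. e i) = of_nat (card I) * g"
      by (simp add: g ennreal_times_divide mult_divide_eq_ennreal mult.commute)
    show ?thesis
      using False by (cases "g = 0") (auto simp: s mult_divide_eq_ennreal)
  qed
  finally show ?thesis .
qed

text \<open>Serves to bound the positive part of the log ratio by an integrable function.\<close>

lemma pos_part_ext_log_le: "pos_part (ext_log r) \<le> r"
proof (cases r)
  case (real x)
  then show ?thesis
    using ln_bound[of x] by (cases "x = 0") (auto simp: ext_log_def pos_part_ereal intro!: ennreal_leI)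
qed simp

text \<open>This is log r \<le> r - 1, rearranged to avoid subtraction in \<open>ennreal\<close>. At
  0 and at infinity the right side is infinite.\<close>

lemma ext_log_le_minus_one: "pos_part (ext_log r) + 1 \<le> r + pos_part (- ext_log r)"
proof (cases r)
  case (real x)
  show ?thesis
  proof (cases "x = 0")
    case False
    then have "max 0 (ln x) + 1 \<le> x + max 0 (- ln x)"
      using ln_le_minus_one[of x] real by (auto simp: max_def)
    then have "ennreal (max 0 (ln x) + 1) \<le> ennreal (x + max 0 (- ln x))"
      by (rule ennreal_leI)
    then have "ennreal (max 0 (ln x)) + ennreal 1 \<le> ennreal x + ennreal (max 0 (- ln x))"
      using real by (simp only: ennreal_plus max.cobounded1 zero_le_one)
    moreover have "ext_log r = ereal (ln x)" using False real by (simp add: ext_log_def)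
    ultimately show ?thesis by (simp only: real pos_part_ereal uminus_ereal.simps ennreal_1)
  qed (use real in \<open>simp add: ext_log_def\<close>)
qed simp

section \<open>Permuted data and exchangeability\<close>

lemma permute_data_measurable:
  assumes "p permutes {1..n}"
  shows "(\<lambda>x. x \<circ> p) \<in> measurable (data_space n) (data_space n)"
  unfolding data_space_def
proof (rule measurable_PiM_single')
  fix i assume "i \<in> {1..n}"
  then have "p i \<in> {1..n}" using permutes_in_image[OF assms] by blast
  then show "(\<lambda>x. (x \<circ> p) i) \<in> borel_measurable (PiM {1..n} (\<lambda>_. borel))" by simp
next
  show "(\<lambda>x. x \<circ> p) \<in> space (PiM {1..n} (\<lambda>_. borel)) \<rightarrow> {1..n} \<rightarrow>\<^sub>E space borel"
    using assms by (auto simp: space_PiM PiE_def extensional_def permutes_not_in)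
qed

text \<open>Composing with \<open>q\<close> on the left is a bijection of the set of permutations,
  so the summands are merely reordered.\<close>

lemma symmetrization_permute:
  assumes "q permutes {1..n}"
  shows "symmetrization n E (x \<circ> q) = symmetrization n E x"
  unfolding symmetrization_def
  by (subst (2) setum_permutations_compose_left[OF assms]) (simp add: comp_assoc)

lemma symmetrization_measurable:
  assumes [measurable]: "E \<in> borel_measurable (data_space n)"
  shows "symmetrization n E \<in> borel_measurable (data_space n)"
proof -
  have "(\<lambda>x. E (x \<circ> p)) \<in> borel_measurable (data_space n)" if "p permutes {1..n}" for p
    using measurable_compose[OF permute_data_measurable[OF that] assms] .
  then show ?thesis
    unfolding symmetrization_def[abs_def] by (intro borel_measurable_divide_ennreal borel_measurable_sum) auto
qed

text \<open>These facts let \<open>symmetrization\<close> be read as an average over a finite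
  nonempty index set, as in the pointwise inequalities.\<close>

lemma permutations_interval:
  "finite {p. p permutes {1..n}}"
  "card {p. p permutes {1..n}} = fact n"
  "{p. p permutes {1..n}} \<noteq> {}"
  using card_permutations[of "{1..n}" n] by (auto simp: finite_permutations intro: permutes_id)

lemma exchangeable_nn_integral:
  assumes "data_distribution n P" "exchangeable n P" "p permutes {1..n}"
    and h: "h \<in> borel_measurable (data_space n)"
  shows "(\<integral>\<^sup>+ x. h (x \<circ> p) \<partial>P) = (\<integral>\<^sup>+ x. h x \<partial>P)"
proof -
  have "(\<lambda>x. x \<circ> p) \<in> measurable P (data_space n)"
    using permute_data_measurable[OF assms(3)] assms(1)
    by (simp add: data_distribution_def cong: measurable_cong_sets)
  then have "(\<integral>\<^sup>+ x. h (x \<circ> p) \<partial>P) = (\<integral>\<^sup>+ x. h x \<partial>distr P (data_space n) (\<lambda>x. x \<circ> p))"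
    by (simp add: nn_integral_distr h)
  then show ?thesis using assms(2,3) by (simp add: exchangeable_def)
qed

text \<open>Under exchangeability every permuted copy of \<open>h\<close> has the same integral.
  This turns pointwise inequalities about sums over copies into inequalities about
  integrals.\<close>

lemma nn_integral_sum_permutations:
  assumes P: "data_distribution n P" "exchangeable n P"
    and h: "h \<in> borel_measurable (data_space n)"
  shows "(\<integral>\<^sup>+ x. (\<Sum>p\<in>{p. p permutes {1..n}}. h (x \<circ> p)) \<partial>P) = of_nat (fact n) * (\<integral>\<^sup>+ x. h x \<partial>P)"
proof -
  have "(\<lambda>x. h (x \<circ> p)) \<in> borel_measurable P" if "p permutes {1..n}" for p
    using measurable_compose[OF permute_data_measurable[OF that] h] P(1)
    by (simp add: data_distribution_def cong: measurable_cong_sets)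
  then have "(\<integral>\<^sup>+ x. (\<Sum>p\<in>{p. p permutes {1..n}}. h (x \<circ> p)) \<partial>P)
      = (\<Sum>p\<in>{p. p permutes {1..n}}. \<integral>\<^sup>+ x. h (x \<circ> p) \<partial>P)"
    by (intro nn_integral_sum) auto
  also have "\<dots> = (\<Sum>p\<in>{p. p permutes {1..n}}. \<integral>\<^sup>+ x. h x \<partial>P)"
    using exchangeable_nn_integral[OF P _ h] by (intro sum.cong) auto
  finally show ?thesis using permutations_interval(2) by simp
qed

lemma symmetrization_nn_integral:
  assumes P: "data_distribution n P" "exchangeable n P" and E: "E \<in> borel_measurable (data_space n)"
  shows "(\<integral>\<^sup>+ x. symmetrization n E x \<partial>P) = (\<integral>\<^sup>+ x. E x \<partial>P)"
proof -
  have "(\<lambda>x. \<Sum>p\<in>{p. p permutes {1..n}}. E (x \<circ> p)) \<in> borel_measurable P"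
    using measurable_compose[OF permute_data_measurable E] P(1)
    by (intro borel_measurable_sum) (auto simp: data_distribution_def cong: measurable_cong_sets)
  then have "(\<integral>\<^sup>+ x. symmetrization n E x \<partial>P) = of_nat (fact n) * (\<integral>\<^sup>+ x. E x \<partial>P) / of_nat (fact n)"
    unfolding symmetrization_def by (simp only: nn_integral_divide nn_integral_sum_permutations[OF P E])
  also have "\<dots> = (\<integral>\<^sup>+ x. E x \<partial>P)"
    using mult_divide_eq_ennreal[of "of_nat (fact n)" "\<integral>\<^sup>+ x. E x \<partial>P"]
    by (simp add: mult.commute del: of_nat_fact One_nat_def)
  finally show ?thesis .
qed

section \<open>Expected utility and expected log ratio\<close>

text \<open>Well-definedness rules out infinity minus infinity on both sides; then the parts can be
  moved back across the inequality, also when one of them is infinite.\<close>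

lemma expect_mono_cross:
  assumes "expect_pos M X + expect_neg M Y \<le> expect_pos M Y + expect_neg M X"
    and "expect_well_defined M X" "expect_well_defined M Y"
  shows "expect M X \<le> expect M Y"
  using assms unfolding expect_well_defined_def expect_def
  by (cases "expect_pos M X"; cases "expect_neg M X"; cases "expect_pos M Y"; cases "expect_neg M Y")
     (auto simp: enn2ereal_ennreal top_unique simp flip: ennreal_plus)

text \<open>The pointwise Jensen inequality for the copies of \<open>E\<close> is integrated. Each
  sum over copies contributes n! times one integral, and the terms in the average already carry the
  factor n!, which is finally cancelled.\<close>

lemma expect_utility_symmetrization:
  assumes P: "data_distribution n P" "exchangeable n P" and E: "E \<in> borel_measurable (data_space n)"
    and f: "concave_on {0<..} f"
    and wd: "expect_well_defined P (\<lambda>x. extend_utility f (symmetrization n E x))"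
      "expect_well_defined P (\<lambda>x. extend_utility f (E x))"
  shows "expect P (\<lambda>x. extend_utility f (E x)) \<le> expect P (\<lambda>x. extend_utility f (symmetrization n E x))"
proof (rule expect_mono_cross[OF _ wd(2,1)])
  let ?S = "{p. p permutes {1..n}}" and ?N = "of_nat (fact n) :: ennreal"
  let ?F = "\<lambda>x. extend_utility f (E x)" and ?H = "\<lambda>x. extend_utility f (symmetrization n E x)"
  note F [measurable] = measurable_compose[OF E borel_measurable_extend_utility[OF f]]
    and H [measurable] = measurable_compose[OF symmetrization_measurable[OF E] borel_measurable_extend_utility[OF f]]
  have meas: "measurable P N = measurable (data_space n) N" for N :: "'x measure"
    using P(1) by (auto simp: data_distribution_def cong: measurable_cong_sets)
  have pF: "(\<lambda>x. pos_part (?F x)) \<in> borel_measurable (data_space n)"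
    and nF: "(\<lambda>x. pos_part (- ?F x)) \<in> borel_measurable (data_space n)"
    and pH: "(\<lambda>x. pos_part (?H x)) \<in> borel_measurable (data_space n)"
    and nH: "(\<lambda>x. pos_part (- ?H x)) \<in> borel_measurable (data_space n)"
    by measurable
  have sumF: "(\<lambda>x. \<Sum>p\<in>?S. h (x \<circ> p)) \<in> borel_measurable (data_space n)"
    if "h \<in> borel_measurable (data_space n)" for h :: "_ \<Rightarrow> ennreal"
    using measurable_compose[OF permute_data_measurable that] by (intro borel_measurable_sum) auto
  have "?N * (expect_pos P ?F + expect_neg P ?H)
      = (\<integral>\<^sup>+ x. (\<Sum>p\<in>?S. pos_part (?F (x \<circ> p))) + ?N * pos_part (- ?H x) \<partial>P)"
    using sumF[OF pF] nH
    by (simp add: expect_pos_def expect_neg_def distrib_left nn_integral_add nn_integral_cmult meas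
        nn_integral_sum_permutations[OF P pF] del: of_nat_fact One_nat_def)
  also have "\<dots> \<le> (\<integral>\<^sup>+ x. ?N * pos_part (?H x) + (\<Sum>p\<in>?S. pos_part (- ?F (x \<circ> p))) \<partial>P)"
  proof (rule nn_integral_mono)
    fix x
    show "(\<Sum>p\<in>?S. pos_part (?F (x \<circ> p))) + ?N * pos_part (- ?H x)
        \<le> ?N * pos_part (?H x) + (\<Sum>p\<in>?S. pos_part (- ?F (x \<circ> p)))"
      using extend_utility_average[OF f permutations_interval(1,3), of _ "\<lambda>p. E (x \<circ> p)" n]
      by (simp add: permutations_interval(2) symmetrization_def del: of_nat_fact One_nat_def)
  qed
  also have "\<dots> = ?N * (expect_pos P ?H + expect_neg P ?F)"
    using sumF[OF nF] pH
    by (simp add: expect_pos_def expect_neg_def distrib_left nn_integral_add nn_integral_cmult meas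
        nn_integral_sum_permutations[OF P nF] del: of_nat_fact One_nat_def)
  \<comment> \<open>Cancelling \<open>?N\<close> is legitimate because n! is neither 0 nor
    infinite.\<close>
  finally show "expect_pos P ?F + expect_neg P ?H \<le> expect_pos P ?H + expect_neg P ?F"
    by (subst (asm) ennreal_mult_le_mult_iff) (auto simp del: of_nat_fact One_nat_def)
qed

lemma nn_integral_ratio_symmetrization_le_1:
  assumes P: "data_distribution n P" "exchangeable n P" and E: "E \<in> borel_measurable (data_space n)"
  shows "(\<integral>\<^sup>+ x. ext_ratio (E x) (symmetrization n E x) \<partial>P) \<le> 1"
proof -
  let ?S = "{p. p permutes {1..n}}" and ?N = "of_nat (fact n) :: ennreal"
  interpret prob_space P using P(1) by (simp add: data_distribution_def)
  have "?N * (\<integral>\<^sup>+ x. ext_ratio (E x) (symmetrization n E x) \<partial>P)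
      = (\<integral>\<^sup>+ x. (\<Sum>p\<in>?S. ext_ratio (E (x \<circ> p)) (symmetrization n E (x \<circ> p))) \<partial>P)"
    by (rule nn_integral_sum_permutations[OF P, symmetric])
       (intro borel_measurable_ext_ratio E symmetrization_measurable)
  \<comment> \<open>By symmetry of the average all copies share one denominator, as
    \<open>sum_ext_ratio_average_le\<close> requires.\<close>
  also have "\<dots> = (\<integral>\<^sup>+ x. (\<Sum>p\<in>?S. ext_ratio (E (x \<circ> p)) (symmetrization n E x)) \<partial>P)"
    by (intro nn_integral_cong sum.cong) (auto simp: symmetrization_permute)
  also have "\<dots> \<le> (\<integral>\<^sup>+ x. ?N \<partial>P)"
  proof (rule nn_integral_mono)
    fix x
    show "(\<Sum>p\<in>?S. ext_ratio (E (x \<circ> p)) (symmetrization n E x)) \<le> ?N"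
      using sum_ext_ratio_average_le[OF permutations_interval(1), of _ "\<lambda>p. E (x \<circ> p)" n]
      by (simp add: permutations_interval(2) symmetrization_def del: of_nat_fact One_nat_def)
  qed
  also have "\<dots> = ?N * 1" by (simp add: emeasure_space_1 del: of_nat_fact One_nat_def)
  finally show ?thesis
    by (subst (asm) ennreal_mult_le_mult_iff) (auto simp del: of_nat_fact One_nat_def)
qed

text \<open>Well-definedness is derived, not assumed: the positive part is at most the ratio, whose
  integral is at most 1. The sign follows by integrating
  \<open>ext_log_le_minus_one\<close>.\<close>

lemma expect_log_ratio_symmetrization:
  assumes P: "data_distribution n P" "exchangeable n P" and E: "E \<in> borel_measurable (data_space n)"
  defines "L \<equiv> \<lambda>x. ext_log (ext_ratio (E x) (symmetrization n E x))"
  shows "expect_well_defined P L" "expect P L \<le> 0"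
proof -
  let ?R = "\<lambda>x. ext_ratio (E x) (symmetrization n E x)"
  interpret prob_space P using P(1) by (simp add: data_distribution_def)
  have sets: "sets P = sets (data_space n)" using P(1) by (simp add: data_distribution_def)
  have R [measurable]: "?R \<in> borel_measurable P"
    using borel_measurable_ext_ratio[OF E symmetrization_measurable[OF E]]
    by (simp add: sets cong: measurable_cong_sets)
  have L [measurable]: "L \<in> borel_measurable P"
    unfolding L_def by (rule measurable_compose[OF R borel_measurable_ext_log])
  have R1: "(\<integral>\<^sup>+ x. ?R x \<partial>P) \<le> 1" by (rule nn_integral_ratio_symmetrization_le_1[OF P E])
  have "expect_pos P L \<le> (\<integral>\<^sup>+ x. ?R x \<partial>P)"
    unfolding expect_pos_def L_def by (intro nn_integral_mono pos_part_ext_log_le)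
  then have fin: "expect_pos P L < \<infinity>"
    using R1 by (auto intro: order.strict_trans1 simp: less_top[symmetric] top_unique)
  then show "expect_well_defined P L" by (simp add: expect_well_defined_def)
  have "expect_pos P L + 1 = (\<integral>\<^sup>+ x. pos_part (L x) + 1 \<partial>P)"
    by (simp add: expect_pos_def nn_integral_add emeasure_space_1)
  also have "\<dots> \<le> (\<integral>\<^sup>+ x. ?R x + pos_part (- L x) \<partial>P)"
    unfolding L_def by (intro nn_integral_mono ext_log_le_minus_one)
  also have "\<dots> = (\<integral>\<^sup>+ x. ?R x \<partial>P) + expect_neg P L"
    by (simp add: expect_neg_def nn_integral_add)
  also have "\<dots> \<le> 1 + expect_neg P L" using R1 by (rule add_right_mono)
  finally have "expect_pos P L \<le> expect_neg P L" by (simp add: add.commute)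
  then have "enn2ereal (expect_pos P L) \<le> enn2ereal (expect_neg P L)"
    by (simp add: less_eq_ennreal.rep_eq)
  \<comment> \<open>Finiteness of the positive part matters here: were both parts infinite, their
    difference in \<open>ereal\<close> would be infinity.\<close>
  then show "expect P L \<le> 0"
    using fin unfolding expect_def
    by (cases "expect_pos P L"; cases "expect_neg P L") (auto simp: enn2ereal_ennreal)
qed

theorem mainTheorem10:
  fixes n :: nat
    and P :: "'t \<Rightarrow> (nat \<Rightarrow> real) measure"
    and \<Theta> \<Theta>0 \<Theta>1 :: "'t set"
    and E G :: "(nat \<Rightarrow> real) \<Rightarrow> ennreal"
  assumes "\<Theta>0 \<union> \<Theta>1 = \<Theta>" and "\<Theta>0 \<inter> \<Theta>1 = {}"
    and "\<And>\<theta>. \<theta> \<in> \<Theta> \<Longrightarrow> data_distribution n (P \<theta>)"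
    and "\<And>\<theta>. \<theta> \<in> \<Theta> \<Longrightarrow> exchangeable n (P \<theta>)"
    and "is_evariable n P \<Theta>0 E"
    and "G = symmetrization n E"
  shows "is_evariable n P \<Theta>0 G
    \<and> (\<forall>\<theta>\<in>\<Theta>. \<forall>f. concave_on {0<..} f
          \<longrightarrow> expect_well_defined (P \<theta>) (\<lambda>x. extend_utility f (G x))
          \<longrightarrow> expect_well_defined (P \<theta>) (\<lambda>x. extend_utility f (E x))
          \<longrightarrow> expect (P \<theta>) (\<lambda>x. extend_utility f (G x)) \<ge> expect (P \<theta>) (\<lambda>x. extend_utility f (E x)))
    \<and> (\<forall>\<theta>\<in>\<Theta>. expect_well_defined (P \<theta>) (\<lambda>x. ext_log (ext_ratio (E x) (G x)))
          \<and> expect (P \<theta>) (\<lambda>x. ext_log (ext_ratio (E x) (G x))) \<le> 0)"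
proof (intro conjI ballI allI impI)
  have E: "E \<in> borel_measurable (data_space n)" using assms(5) by (simp add: is_evariable_def)
  \<comment> \<open>Exchangeability holds on \<Theta>, hence on \<Theta>0, so \<open>G\<close>
    inherits the expectation of \<open>E\<close> under the null.\<close>
  show "is_evariable n P \<Theta>0 G"
    using assms(1,3-5) symmetrization_measurable[OF E] symmetrization_nn_integral[OF _ _ E]
    by (auto simp: is_evariable_def assms(6))
  fix \<theta> assume "\<theta> \<in> \<Theta>"
  then have P: "data_distribution n (P \<theta>)" "exchangeable n (P \<theta>)" using assms(3,4) by auto
  show "expect_well_defined (P \<theta>) (\<lambda>x. ext_log (ext_ratio (E x) (G x)))"
    "expect (P \<theta>) (\<lambda>x. ext_log (ext_ratio (E x) (G x))) \<le> 0"
    using expect_log_ratio_symmetrization[OF P E] by (simp_all add: assms(6))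
  fix f :: "real \<Rightarrow> real"
  assume "concave_on {0<..} f"
    "expect_well_defined (P \<theta>) (\<lambda>x. extend_utility f (G x))"
    "expect_well_defined (P \<theta>) (\<lambda>x. extend_utility f (E x))"
  then show "expect (P \<theta>) (\<lambda>x. extend_utility f (E x)) \<le> expect (P \<theta>) (\<lambda>x. extend_utility f (G x))"
    using expect_utility_symmetrization[OF P E] by (simp add: assms(6))
qed

end
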